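(* Let $n\ge2$ and $d\ge0$. The dimension of $((V^{(n)}\oplus V^{(n-1,1)})^{\otimes d})^{\mathfrak S_n}\simeq\mathbb Q\langle X_n\rangle_d^{\mathfrak S_n}$ is equal to the number of words of length $d$ which reduce to the identity in the Cayley graph $\Gamma(\mathfrak S_n,\{e,(1\,2),(1\,3\,2),\dots,(1\,n\,\cdots\,4\,3\,2)\})$.
   Context: $\mathfrak S_n$ is the symmetric group on $\{1,\dots,n\}$ with identity $e$. $V^{(n)}\oplus V^{(n-1,1)}$ (trivial plus geometric module) is the permutation module over $\mathbb Q$, with basis $x_1,\dots,x_n$ permuted by $\mathfrak S_n$. $\mathfrak S_n$ acts diagonally on tensor powers; $(\cdot)^{\mathfrak S_n}$ denotes the subspace of invariants. The tensor algebra of the permutation module is identified with the non-commutative polynomial algebra $\mathbb Q\langle X_n\rangle=\mathbb Q\langle x_1,\dots,x_n\rangle$; the subscript $d$ denotes the homogeneous component of degree $d$. The set of generators is $S=\{e,c_2,\dots,c_n\}$ with $c_k=(1\;k\;k-1\;\cdots\;2)$ in cycle notation. In the Cayley graph $\Gamma(G,S)$ there is a directed edge $g\to gs$ for each $g\in G$, $s\in S$; a word of length $d$ which reduces to $g$ is a sequence $(s_1,\dots,s_d)\in S^d$ with $s_1\cdots s_d=g$ in $G$ (the letter $e$ is a genuine letter, counted in the length). *)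

theory Defs
  imports Complex_Main "HOL-Algebra.Sym_Groups" "HOL-Library.Poly_Mapping"
begin

text \<open>
  Free rational vector spaces: \<open>'a \<Rightarrow>\<^sub>0 rat\<close> is the space with basis \<open>'a\<close>, the basis vector
  belonging to \<open>i\<close> being \<open>Poly_Mapping.single i 1\<close>.
\<close>

lift_definition qscale :: "rat \<Rightarrow> ('a \<Rightarrow>\<^sub>0 rat) \<Rightarrow> ('a \<Rightarrow>\<^sub>0 rat)"
  is "\<lambda>c f x. c * f x"
  by (rule finite_subset) auto

lemma lookup_qscale [simp]: "Poly_Mapping.lookup (qscale c p) x = c * Poly_Mapping.lookup p x"
  by transfer simp

global_interpretation qvec: vector_space qscale
  by unfold_locales (auto intro!: poly_mapping_eqI simp: lookup_add algebra_simps)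

abbreviation basis_vec :: "'a \<Rightarrow> ('a \<Rightarrow>\<^sub>0 rat)"
  where "basis_vec i \<equiv> Poly_Mapping.single i 1"

text \<open>The linear extension of the map of basis vectors induced by \<open>f\<close>.\<close>

definition relabel :: "('a \<Rightarrow> 'b) \<Rightarrow> ('a \<Rightarrow>\<^sub>0 rat) \<Rightarrow> ('b \<Rightarrow>\<^sub>0 rat)"
  where "relabel f p = (\<Sum>k\<in>Poly_Mapping.keys p. Poly_Mapping.single (f k) (Poly_Mapping.lookup p k))"

lemma relabel_superset:
  assumes "finite A" "Poly_Mapping.keys p \<subseteq> A"
  shows "relabel f p = (\<Sum>k\<in>A. Poly_Mapping.single (f k) (Poly_Mapping.lookup p k))"
  unfolding relabel_def
  by (rule sum.mono_neutral_left) (use assms in \<open>auto simp: in_keys_iff\<close>)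

lemma relabel_basis_vec [simp]: "relabel f (basis_vec i) = basis_vec (f i)"
  by (simp add: relabel_def)

lemma relabel_add: "relabel f (p + q) = relabel f p + relabel f q"
proof -
  have *: "finite (Poly_Mapping.keys p \<union> Poly_Mapping.keys q)" by simp
  show ?thesis
    using Poly_Mapping.keys_add[of p q]
    by (simp add: relabel_superset[OF *] lookup_add single_add sum.distrib)
qed

lemma relabel_qscale:
  fixes f :: "'a \<Rightarrow> 'b"
  shows "relabel f (qscale c p) = qscale c (relabel f p)"
proof -
  have k: "Poly_Mapping.keys (qscale c p) \<subseteq> Poly_Mapping.keys p"
    by (auto simp: in_keys_iff)
  have s: "qscale c (Poly_Mapping.single x y) = Poly_Mapping.single x (c * y)" for x :: 'b and y
    by (rule poly_mapping_eqI) (simp add: lookup_single when_def)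
  show ?thesis
    by (subst relabel_superset[OF finite_keys k])
      (simp add: relabel_def qvec.scale_sum_right s)
qed

lemma linear_relabel: "Vector_Spaces.linear qscale qscale (relabel f)"
  by unfold_locales (simp_all add: relabel_add relabel_qscale)

lemma relabel_diff: "relabel f (p - q) = relabel f p - relabel f q"
proof -
  interpret Vector_Spaces.linear qscale qscale "relabel f" by (rule linear_relabel)
  show ?thesis by (rule diff)
qed


section \<open>The permutation module\<close>

text \<open>
  \<open>relabel \<sigma>\<close> is the action \<open>x\<^sub>i \<mapsto> x\<^bsub>\<sigma> i\<^esub>\<close>. All modules live in the space with basis
  \<open>x\<^sub>0, x\<^sub>1, x\<^sub>2, \<dots>\<close>, so that \<open>n\<close> can be an ordinary variable.
\<close>

definition perm_module :: "nat \<Rightarrow> (nat \<Rightarrow>\<^sub>0 rat) set"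
  where "perm_module n = qvec.span (basis_vec ` {1..n})"

definition trivial_module :: "nat \<Rightarrow> (nat \<Rightarrow>\<^sub>0 rat) set"
  where "trivial_module n = qvec.span {\<Sum>i=1..n. basis_vec i}"

definition geometric_module :: "nat \<Rightarrow> (nat \<Rightarrow>\<^sub>0 rat) set"
  where "geometric_module n = {v \<in> perm_module n. (\<Sum>i=1..n. Poly_Mapping.lookup v i) = 0}"

definition internal_sum :: "('a \<Rightarrow>\<^sub>0 rat) set \<Rightarrow> ('a \<Rightarrow>\<^sub>0 rat) set \<Rightarrow> ('a \<Rightarrow>\<^sub>0 rat) set"
  where "internal_sum U W = {u + w | u w. u \<in> U \<and> w \<in> W}"

lemma lookup_sum_basis:
  "Poly_Mapping.lookup (\<Sum>i=1..n. basis_vec i) j = (if j \<in> {1..n} then 1 else 0)" for n j :: nat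
  by (simp add: lookup_sum lookup_single when_def)

lemma trivial_subset_perm: "trivial_module n \<subseteq> perm_module n"
  unfolding trivial_module_def perm_module_def
  by (intro qvec.span_minimal qvec.subspace_span)
    (auto intro!: qvec.span_sum intro: qvec.span_base simp del: One_nat_def)

text \<open>The sum is direct and is all of the permutation module.\<close>

lemma perm_module_eq_sum:
  assumes "n \<ge> 1"
  shows "internal_sum (trivial_module n) (geometric_module n) = perm_module n"
proof (intro subset_antisym subsetI)
  fix x assume "x \<in> internal_sum (trivial_module n) (geometric_module n)"
  then show "x \<in> perm_module n"
    using trivial_subset_perm
    by (auto simp: internal_sum_def geometric_module_def perm_module_def intro: qvec.span_add)
next
  fix x assume x: "x \<in> perm_module n"
  define t where "t = qscale ((\<Sum>i=1..n. Poly_Mapping.lookup x i) / of_nat n) (\<Sum>i=1..n. basis_vec i)"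
  have t: "t \<in> trivial_module n"
    unfolding t_def trivial_module_def by (intro qvec.span_scale qvec.span_base) simp
  have "x - t \<in> perm_module n"
    using x t trivial_subset_perm unfolding perm_module_def by (blast intro: qvec.span_diff)
  moreover have "(\<Sum>i=1..n. Poly_Mapping.lookup (x - t) i) = 0"
    using assms
    by (simp add: t_def lookup_minus lookup_sum_basis sum_subtractf del: One_nat_def)
  ultimately have "x - t \<in> geometric_module n" by (simp add: geometric_module_def)
  moreover have "x = t + (x - t)" by simp
  ultimately show "x \<in> internal_sum (trivial_module n) (geometric_module n)"
    using t unfolding internal_sum_def by blast
qed

lemma trivial_inter_geometric:
  assumes "n \<ge> 1"
  shows "trivial_module n \<inter> geometric_module n = {0}"
proof -
  have "x = 0" if "x \<in> trivial_module n" "x \<in> geometric_module n" for x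
  proof -
    from that(1) obtain c where c: "x = qscale c (\<Sum>i=1..n. basis_vec i)"
      by (auto simp: trivial_module_def qvec.span_singleton)
    have "of_nat n * c = 0"
      using that(2) by (simp add: c geometric_module_def lookup_sum_basis del: One_nat_def)
    with assms c show ?thesis by simp
  qed
  then show ?thesis
    by (auto simp: trivial_module_def geometric_module_def perm_module_def qvec.span_zero)
qed


section \<open>Tensor powers\<close>

text \<open>
  The tensor algebra of \<open>'a \<Rightarrow>\<^sub>0 rat\<close>: the free vector space on all finite sequences of vectors,
  modulo multilinearity. A sequence \<open>[v\<^sub>1, \<dots>, v\<^sub>d]\<close> represents the pure tensor
  \<open>v\<^sub>1 \<otimes> \<dots> \<otimes> v\<^sub>d\<close>; the relations preserve the length of sequences.
\<close>

definition multilinear_rels :: "(('a \<Rightarrow>\<^sub>0 rat) list \<Rightarrow>\<^sub>0 rat) set"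
  where "multilinear_rels = qvec.span
    ({basis_vec (us @ (v + w) # ws) - basis_vec (us @ v # ws) - basis_vec (us @ w # ws)
        | us v w ws. True} \<union>
     {basis_vec (us @ qscale c v # ws) - qscale c (basis_vec (us @ v # ws))
        | us c v ws. True})"

lemma multilinear_rels_simps:
  "0 \<in> multilinear_rels"
  "p \<in> multilinear_rels \<Longrightarrow> q \<in> multilinear_rels \<Longrightarrow> p + q \<in> multilinear_rels"
  "p \<in> multilinear_rels \<Longrightarrow> q \<in> multilinear_rels \<Longrightarrow> p - q \<in> multilinear_rels"
  "p \<in> multilinear_rels \<Longrightarrow> - p \<in> multilinear_rels"
  "p \<in> multilinear_rels \<Longrightarrow> qscale c p \<in> multilinear_rels"
  unfolding multilinear_rels_def
  by (auto intro: qvec.span_zero qvec.span_add qvec.span_diff qvec.span_neg qvec.span_scale)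

quotient_type 'a tensor_algebra =
  "('a \<Rightarrow>\<^sub>0 rat) list \<Rightarrow>\<^sub>0 rat" / "\<lambda>p q. p - q \<in> multilinear_rels"
proof (intro equivpI reflpI sympI transpI)
  fix p q r :: "('a \<Rightarrow>\<^sub>0 rat) list \<Rightarrow>\<^sub>0 rat"
  show "p - p \<in> multilinear_rels" by (simp add: multilinear_rels_simps)
  show "q - p \<in> multilinear_rels" if "p - q \<in> multilinear_rels"
    using multilinear_rels_simps(4)[OF that] by simp
  show "p - r \<in> multilinear_rels" if "p - q \<in> multilinear_rels" "q - r \<in> multilinear_rels"
    using multilinear_rels_simps(2)[OF that] by simp
qed

instantiation tensor_algebra :: (type) ab_group_add
begin

lift_definition zero_tensor_algebra :: "'a tensor_algebra" is 0 .

lift_definition plus_tensor_algebra ::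
    "'a tensor_algebra \<Rightarrow> 'a tensor_algebra \<Rightarrow> 'a tensor_algebra" is "(+)"
  subgoal for p p' q q'
    using multilinear_rels_simps(2)[of "p - p'" "q - q'"] by (simp add: algebra_simps)
  done

lift_definition minus_tensor_algebra ::
    "'a tensor_algebra \<Rightarrow> 'a tensor_algebra \<Rightarrow> 'a tensor_algebra" is "(-)"
  subgoal for p p' q q'
    using multilinear_rels_simps(3)[of "p - p'" "q - q'"] by (simp add: algebra_simps)
  done

lift_definition uminus_tensor_algebra :: "'a tensor_algebra \<Rightarrow> 'a tensor_algebra" is uminus
  subgoal for p p'
    using multilinear_rels_simps(4)[of "p - p'"] by (simp add: algebra_simps)
  done

instance
  by standard (transfer; simp add: multilinear_rels_simps algebra_simps)+

end

lift_definition tscale :: "rat \<Rightarrow> 'a tensor_algebra \<Rightarrow> 'a tensor_algebra" is qscale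
  subgoal for c p q
    using multilinear_rels_simps(5)[of "p - q" c] by (simp add: qvec.scale_right_diff_distrib)
  done

global_interpretation tvec: vector_space tscale
  by unfold_locales
    (transfer; simp add: multilinear_rels_simps qvec.scale_right_distrib qvec.scale_left_distrib)+

definition pure_tensor :: "('a \<Rightarrow>\<^sub>0 rat) list \<Rightarrow> 'a tensor_algebra"
  where "pure_tensor vs = abs_tensor_algebra (basis_vec vs)"

text \<open>
  For a subspace \<open>U\<close>, the tensor power \<open>U\<^bsup>\<otimes>d\<^esup>\<close> is its (injective, as we are over a field) image in
  the tensor algebra of the whole space.
\<close>

definition tensor_power :: "('a \<Rightarrow>\<^sub>0 rat) set \<Rightarrow> nat \<Rightarrow> 'a tensor_algebra set"
  where "tensor_power U d = tvec.span {pure_tensor vs | vs. length vs = d \<and> set vs \<subseteq> U}"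

lemma relabel_multilinear_rels:
  assumes "p \<in> multilinear_rels"
  shows "relabel (map (relabel \<sigma>)) p \<in> multilinear_rels"
proof -
  interpret Vector_Spaces.linear qscale qscale "relabel (map (relabel \<sigma>))"
    by (rule linear_relabel)
  show ?thesis
    using assms[unfolded multilinear_rels_def]
  proof (induction rule: qvec.span_induct_alt)
    case base
    show ?case by (simp add: multilinear_rels_simps)
  next
    case (step c x y)
    then have "relabel (map (relabel \<sigma>)) x \<in> multilinear_rels"
      unfolding multilinear_rels_def
      by (intro qvec.span_base)
        (fastforce simp: relabel_diff relabel_add relabel_qscale)
    with step show ?case
      by (simp add: relabel_add relabel_qscale multilinear_rels_simps)
  qed
qed

lift_definition diagonal_act :: "('a \<Rightarrow> 'a) \<Rightarrow> 'a tensor_algebra \<Rightarrow> 'a tensor_algebra"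
  is "\<lambda>\<sigma>. relabel (map (relabel \<sigma>))"
  by (metis relabel_diff relabel_multilinear_rels)

lemma diagonal_act_pure_tensor:
  "diagonal_act \<sigma> (pure_tensor vs) = pure_tensor (map (relabel \<sigma>) vs)"
  by (simp add: pure_tensor_def diagonal_act.abs_eq)

lemma linear_diagonal_act: "Vector_Spaces.linear tscale tscale (diagonal_act \<sigma>)"
  by unfold_locales (transfer; simp add: relabel_add relabel_qscale multilinear_rels_simps)+


section \<open>Non-commutative polynomials\<close>

text \<open>
  A non-commutative polynomial is a finitely supported function on words, the word
  \<open>[i\<^sub>1, \<dots>, i\<^sub>d]\<close> standing for the monomial \<open>x\<^bsub>i\<^sub>1\<^esub> \<cdots> x\<^bsub>i\<^sub>d\<^esub>\<close>.
\<close>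

type_synonym nc_poly = "nat list \<Rightarrow>\<^sub>0 rat"

definition nc_homogeneous :: "nat \<Rightarrow> nat \<Rightarrow> nc_poly set"
  where "nc_homogeneous n d = {p. \<forall>w\<in>Poly_Mapping.keys p. length w = d \<and> set w \<subseteq> {1..n}}"

definition nc_act :: "(nat \<Rightarrow> nat) \<Rightarrow> nc_poly \<Rightarrow> nc_poly"
  where "nc_act \<sigma> = relabel (map \<sigma>)"


section \<open>Invariants and words in the Cayley graph\<close>

definition sym_invariants :: "nat \<Rightarrow> ((nat \<Rightarrow> nat) \<Rightarrow> 'v \<Rightarrow> 'v) \<Rightarrow> 'v set \<Rightarrow> 'v set"
  where "sym_invariants n act W = {t \<in> W. \<forall>\<sigma>\<in>carrier (sym_group n). act \<sigma> t = t}"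

definition cayley_words :: "('g, 'm) monoid_scheme \<Rightarrow> 'g set \<Rightarrow> nat \<Rightarrow> 'g \<Rightarrow> 'g list set"
  where "cayley_words G S d g =
    {ss. length ss = d \<and> set ss \<subseteq> S \<and> foldr (\<otimes>\<^bsub>G\<^esub>) ss \<one>\<^bsub>G\<^esub> = g}"

text \<open>The cycle \<open>(1 k k-1 \<dots> 2)\<close>, which sends 1 to \<open>k\<close> and \<open>i\<close> to \<open>i - 1\<close> for \<open>2 \<le> i \<le> k\<close>.\<close>

definition gen_cycle :: "nat \<Rightarrow> nat \<Rightarrow> nat"
  where "gen_cycle k = cycle_of_list (1 # rev [2..<Suc k])"

definition cayley_gens :: "nat \<Rightarrow> (nat \<Rightarrow> nat) set"
  where "cayley_gens n = insert \<one>\<^bsub>sym_group n\<^esub> (gen_cycle ` {2..n})"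

end

theory Submission
  imports Defs
begin

text \<open>
  Both sides count \<^emph>\<open>restricted growth words\<close>: words over \<open>{1..n}\<close> in which the letters that occur
  are \<open>1, \<dots>, m\<close> for some \<open>m\<close> and make their first appearances in this order. They encode the
  partitions of the \<open>d\<close> positions into at most \<open>n\<close> blocks.

  On the side of the invariants, expanding tensors in the basis \<open>x\<^sub>1, \<dots>, x\<^sub>n\<close> is an equivariant linear
  isomorphism from the \<open>d\<close>-th tensor power of the permutation module onto the homogeneous
  non-commutative polynomials of degree \<open>d\<close> (\<open>tensor_to_poly_invariants\<close>). There the group permutes
  a basis, the words, so the orbit sums form a basis of the invariants. Every orbit contains exactly
  one restricted growth word: renaming the letters in the order of their first appearance produces
  one, and the order of first appearance leaves no choice. Hence \<open>dim_invariant_polys\<close>.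

  On the side of the Cayley graph, read a permutation \<open>\<sigma>\<close> as the deck of cards
  \<open>\<sigma> 1, \<dots>, \<sigma> n\<close>. Multiplication by the generator \<open>(1 k k-1 \<dots> 2)\<close> on the right moves the card at
  position \<open>k\<close> to the front, and the letter \<open>e\<close> is the case \<open>k = 1\<close>. A sequence of such moves is
  determined by the sequence of the cards that it moves, and every sequence of cards can be
  prescribed. Afterwards the moved cards lie on top, the most recently moved one first, and the cards
  never moved lie below in their original order. So the deck is back in its initial order if and only
  if the sequence of moved cards, read from the last one to the first one, is a restricted growth
  word (\<open>map_shuffle_eq_deck\<close>, \<open>restricted_growth_iff_deck\<close>). Hence \<open>card_cayley_words\<close>.
\<close>

section \<open>Linear maps out of free vector spaces\<close>

lemma lookup_sum_basis_vecs:
  assumes "finite A"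
  shows "Poly_Mapping.lookup (\<Sum>u\<in>A. basis_vec u) v = (if v \<in> A then 1 else 0)"
  using assms by (simp add: lookup_sum lookup_single when_def)

lemma free_vector_eq_sum:
  "p = (\<Sum>k\<in>Poly_Mapping.keys p. qscale (Poly_Mapping.lookup p k) (basis_vec k))"
  by (rule poly_mapping_eqI)
    (simp add: lookup_sum lookup_single when_def in_keys_iff if_distrib[of "(*) _"] cong: if_cong)

lemma span_basis_vec: "qvec.span (basis_vec ` A) = {p. Poly_Mapping.keys p \<subseteq> A}"
proof (intro subset_antisym subsetI)
  have "qvec.subspace {p :: 'a \<Rightarrow>\<^sub>0 rat. Poly_Mapping.keys p \<subseteq> A}"
  proof (rule qvec.subspaceI)
    show "p + q \<in> {p. Poly_Mapping.keys p \<subseteq> A}"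
      if "p \<in> {p. Poly_Mapping.keys p \<subseteq> A}" "q \<in> {p. Poly_Mapping.keys p \<subseteq> A}"
      for p q :: "'a \<Rightarrow>\<^sub>0 rat"
      using that Poly_Mapping.keys_add[of p q] by blast
    show "qscale c p \<in> {p. Poly_Mapping.keys p \<subseteq> A}"
      if "p \<in> {p. Poly_Mapping.keys p \<subseteq> A}" for c and p :: "'a \<Rightarrow>\<^sub>0 rat"
      using that by (auto simp: in_keys_iff subset_iff)
  qed simp
  then have "qvec.span (basis_vec ` A) \<subseteq> {p. Poly_Mapping.keys p \<subseteq> A}"
    by (intro qvec.span_minimal) auto
  then show "p \<in> {p. Poly_Mapping.keys p \<subseteq> A}" if "p \<in> qvec.span (basis_vec ` A)" for p
    using that by blast
next
  fix p :: "'a \<Rightarrow>\<^sub>0 rat" assume "p \<in> {p. Poly_Mapping.keys p \<subseteq> A}"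
  then have "(\<Sum>k\<in>Poly_Mapping.keys p. qscale (Poly_Mapping.lookup p k) (basis_vec k))
      \<in> qvec.span (basis_vec ` A)"
    by (intro qvec.span_sum qvec.span_scale qvec.span_base) blast
  then show "p \<in> qvec.span (basis_vec ` A)" by (simp flip: free_vector_eq_sum)
qed

definition linear_extension ::
    "(rat \<Rightarrow> 'b \<Rightarrow> 'b :: ab_group_add) \<Rightarrow> ('a \<Rightarrow> 'b) \<Rightarrow> ('a \<Rightarrow>\<^sub>0 rat) \<Rightarrow> 'b"
  where "linear_extension s g p = (\<Sum>k\<in>Poly_Mapping.keys p. s (Poly_Mapping.lookup p k) (g k))"

lemma linear_extension_superset:
  assumes "vector_space s" "finite A" "Poly_Mapping.keys p \<subseteq> A"
  shows "linear_extension s g p = (\<Sum>k\<in>A. s (Poly_Mapping.lookup p k) (g k))"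
proof -
  interpret vector_space s by fact
  show ?thesis
    unfolding linear_extension_def
    by (rule sum.mono_neutral_left) (use assms in \<open>auto simp: in_keys_iff\<close>)
qed

lemma linear_extension_basis_vec [simp]:
  assumes "vector_space s"
  shows "linear_extension s g (basis_vec k) = g k"
proof -
  interpret vector_space s by fact
  show ?thesis by (simp add: linear_extension_def)
qed

lemma linear_linear_extension:
  assumes "vector_space s"
  shows "Vector_Spaces.linear qscale s (linear_extension s g)"
proof -
  interpret vector_space s by fact
  interpret vector_space_pair qscale s by unfold_locales
  show ?thesis
  proof (unfold Vector_Spaces.linear_iff, intro conjI allI)
    fix p q :: "'b \<Rightarrow>\<^sub>0 rat" and c :: rat
    have fin: "finite (Poly_Mapping.keys p \<union> Poly_Mapping.keys q)" by simp
    show "linear_extension s g (p + q) = linear_extension s g p + linear_extension s g q"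
      using Poly_Mapping.keys_add[of p q]
      by (simp add: linear_extension_superset[OF assms fin] lookup_add scale_left_distrib
          sum.distrib)
    have k: "Poly_Mapping.keys (qscale c p) \<subseteq> Poly_Mapping.keys p"
      by (auto simp: in_keys_iff)
    show "linear_extension s g (qscale c p) = s c (linear_extension s g p)"
      unfolding linear_extension_superset[OF assms finite_keys k]
      by (simp add: linear_extension_def scale_sum_right)
  qed unfold_locales
qed

lemma lookup_relabel_inj:
  assumes "inj f"
  shows "Poly_Mapping.lookup (relabel f p) (f k) = Poly_Mapping.lookup p k"
  using assms
  by (auto simp: relabel_def lookup_sum lookup_single when_def inj_eq in_keys_iff)

text \<open>
  An injective linear map carries a maximal independent subset of \<open>V\<close> to one of \<open>f ` V\<close>.
\<close>

lemma dim_linear_image: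
  assumes "Vector_Spaces.linear s1 s2 f" "inj f"
  shows "vector_space.dim s2 (f ` V) = vector_space.dim s1 V"
proof -
  interpret Vector_Spaces.linear s1 s2 f by fact
  obtain B where B: "B \<subseteq> V" "vs1.independent B" "V \<subseteq> vs1.span B" "card B = vs1.dim V"
    by (rule vs1.basis_exists)
  have inj: "inj_on f X" for X using assms(2) by (rule inj_on_subset) simp
  show ?thesis
  proof (rule vs2.dim_unique)
    show "f ` B \<subseteq> f ` V" using B by blast
    show "f ` V \<subseteq> vs2.span (f ` B)" using B by (intro spans_image)
    show "vs2.independent (f ` B)" using B inj by (intro independent_injective_image)
    show "card (f ` B) = vs1.dim V" using B inj by (simp add: card_image)
  qed
qed

section \<open>The tensor algebra as an algebra of non-commutative polynomials\<close>

text \<open>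
  The product of the linear polynomials \<open>\<Sum>\<^sub>i v\<^sub>i x\<^sub>i\<close> belonging to the entries of a list. Writing
  each factor as a linear extension makes linearity in each entry immediate.
\<close>

primrec expand :: "('a \<Rightarrow>\<^sub>0 rat) list \<Rightarrow> ('a list \<Rightarrow>\<^sub>0 rat)"
  where
    "expand [] = basis_vec []"
  | "expand (v # vs) = linear_extension qscale (\<lambda>i. relabel (Cons i) (expand vs)) v"

lemma expand_basis_vecs: "expand (map basis_vec w) = basis_vec w"
  by (induction w) (simp_all add: qvec.vector_space_axioms)

lemma expand_add: "expand (us @ (v + w) # ws) = expand (us @ v # ws) + expand (us @ w # ws)"
proof (induction us)
  case Nil
  interpret Vector_Spaces.linear qscale qscale
    "linear_extension qscale (\<lambda>i. relabel (Cons i) (expand ws))"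
    by (rule linear_linear_extension[OF qvec.vector_space_axioms])
  show ?case by (simp add: add)
next
  case (Cons u us)
  then show ?case
    by (simp add: linear_extension_def relabel_add qvec.scale_right_distrib sum.distrib)
qed

lemma expand_scale: "expand (us @ qscale c v # ws) = qscale c (expand (us @ v # ws))"
proof (induction us)
  case Nil
  interpret Vector_Spaces.linear qscale qscale
    "linear_extension qscale (\<lambda>i. relabel (Cons i) (expand ws))"
    by (rule linear_linear_extension[OF qvec.vector_space_axioms])
  show ?case by (simp add: scale)
next
  case (Cons u us)
  then show ?case
    by (simp add: linear_extension_def relabel_qscale qvec.scale_sum_right mult.commute)
qed

lemma linear_extension_expand_rels:
  assumes "p \<in> multilinear_rels"
  shows "linear_extension qscale expand p = 0"
proof -
  interpret Vector_Spaces.linear qscale qscale "linear_extension qscale expand"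
    by (rule linear_linear_extension[OF qvec.vector_space_axioms])
  show ?thesis
    using assms unfolding multilinear_rels_def
    by (rule eq_0_on_span[rotated])
      (auto simp: diff scale qvec.vector_space_axioms expand_add expand_scale)
qed

text \<open>
  Multiplying out is multilinear, so it descends to the tensor algebra. This is the usual
  identification of the tensor algebra of a free vector space with non-commutative polynomials.
\<close>

lift_definition tensor_to_poly :: "'a tensor_algebra \<Rightarrow> ('a list \<Rightarrow>\<^sub>0 rat)"
  is "linear_extension qscale expand"
proof -
  fix p q :: "('a \<Rightarrow>\<^sub>0 rat) list \<Rightarrow>\<^sub>0 rat"
  assume rel: "p - q \<in> multilinear_rels"
  interpret Vector_Spaces.linear qscale qscale "linear_extension qscale expand"
    by (rule linear_linear_extension[OF qvec.vector_space_axioms])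
  show "linear_extension qscale expand p = linear_extension qscale expand q"
    using linear_extension_expand_rels[OF rel] by (simp add: diff)
qed

lemma linear_tensor_to_poly: "Vector_Spaces.linear tscale qscale tensor_to_poly"
proof -
  interpret Vector_Spaces.linear qscale qscale "linear_extension qscale expand"
    by (rule linear_linear_extension[OF qvec.vector_space_axioms])
  show ?thesis
    by unfold_locales (transfer; simp add: add scale)+
qed

lemma linear_abs_tensor_algebra: "Vector_Spaces.linear qscale tscale abs_tensor_algebra"
  by unfold_locales (simp_all add: plus_tensor_algebra.abs_eq tscale.abs_eq)

abbreviation basis_tensor :: "'a list \<Rightarrow> 'a tensor_algebra"
  where "basis_tensor w \<equiv> pure_tensor (map basis_vec w)"

lemma tensor_to_poly_basis_tensor: "tensor_to_poly (basis_tensor w) = basis_vec w"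
  by (simp add: pure_tensor_def tensor_to_poly.abs_eq qvec.vector_space_axioms expand_basis_vecs)

lemma pure_tensor_add:
  "pure_tensor (us @ (v + w) # ws) = pure_tensor (us @ v # ws) + pure_tensor (us @ w # ws)"
proof -
  have "basis_vec (us @ (v + w) # ws) - basis_vec (us @ v # ws) - basis_vec (us @ w # ws)
      \<in> multilinear_rels"
    unfolding multilinear_rels_def by (rule qvec.span_base) blast
  then show ?thesis
    by (simp add: pure_tensor_def plus_tensor_algebra.abs_eq tensor_algebra.abs_eq_iff
        diff_diff_eq)
qed

lemma pure_tensor_scale:
  "pure_tensor (us @ qscale c v # ws) = tscale c (pure_tensor (us @ v # ws))"
proof -
  have "basis_vec (us @ qscale c v # ws) - qscale c (basis_vec (us @ v # ws)) \<in> multilinear_rels"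
    unfolding multilinear_rels_def by (rule qvec.span_base) blast
  then show ?thesis
    by (simp add: pure_tensor_def tscale.abs_eq tensor_algebra.abs_eq_iff)
qed

text \<open>
  Multilinearity, used one factor at a time: the factors already replaced by basis vectors form the
  prefix \<open>u\<close>, and the induction consumes the remaining ones.
\<close>

lemma pure_tensor_in_span_basis_tensors:
  assumes "set u \<subseteq> A" "set vs \<subseteq> qvec.span (basis_vec ` A)"
  shows "pure_tensor (map basis_vec u @ vs)
    \<in> tvec.span (basis_tensor ` {w. length w = length u + length vs \<and> set w \<subseteq> A})"
  using assms
proof (induction vs arbitrary: u)
  case Nil
  then show ?case by (auto intro!: tvec.span_base)
next
  case (Cons v vs)
  let ?T = "tvec.span (basis_tensor ` {w. length w = length u + length (v # vs) \<and> set w \<subseteq> A})"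
  interpret vector_space_pair qscale tscale by unfold_locales
  have lin: "Vector_Spaces.linear qscale tscale (\<lambda>v. pure_tensor (map basis_vec u @ v # vs))"
    by (simp add: Vector_Spaces.linear_iff pure_tensor_add pure_tensor_scale
        qvec.vector_space_axioms tvec.vector_space_axioms)
  interpret Vector_Spaces.linear qscale tscale "\<lambda>v. pure_tensor (map basis_vec u @ v # vs)"
    by (rule lin)
  have "pure_tensor (map basis_vec u @ basis_vec a # vs) \<in> ?T" if "a \<in> A" for a
    using Cons.IH[of "u @ [a]"] Cons.prems that by simp
  then have "basis_vec ` A \<subseteq> {v. pure_tensor (map basis_vec u @ v # vs) \<in> ?T}" by blast
  moreover have "qvec.subspace {v. pure_tensor (map basis_vec u @ v # vs) \<in> ?T}"
    by (rule subspace_linear_preimage) simp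
  ultimately have "qvec.span (basis_vec ` A) \<subseteq> {v. pure_tensor (map basis_vec u @ v # vs) \<in> ?T}"
    by (rule qvec.span_minimal)
  then show ?case using Cons.prems by auto
qed

lemma tensor_power_eq_span_basis_tensors:
  "tensor_power (qvec.span (basis_vec ` A)) d
    = tvec.span (basis_tensor ` {w. length w = d \<and> set w \<subseteq> A})"
proof (rule subset_antisym)
  show "tensor_power (qvec.span (basis_vec ` A)) d
      \<subseteq> tvec.span (basis_tensor ` {w. length w = d \<and> set w \<subseteq> A})"
    unfolding tensor_power_def
    using pure_tensor_in_span_basis_tensors[of "[]" A]
    by (intro tvec.span_minimal tvec.subspace_span) fastforce
  show "tvec.span (basis_tensor ` {w. length w = d \<and> set w \<subseteq> A})
      \<subseteq> tensor_power (qvec.span (basis_vec ` A)) d"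
    unfolding tensor_power_def
  proof (rule tvec.span_mono, rule image_subsetI)
    fix w assume "w \<in> {w. length w = d \<and> set w \<subseteq> A}"
    then have "length (map basis_vec w) = d \<and> set (map basis_vec w) \<subseteq> qvec.span (basis_vec ` A)"
      by (auto intro: qvec.span_base)
    then show "basis_tensor w
      \<in> {pure_tensor vs | vs. length vs = d \<and> set vs \<subseteq> qvec.span (basis_vec ` A)}"
      by blast
  qed
qed

lemma span_basis_tensors: "tvec.span (range basis_tensor) = UNIV"
proof (rule subset_antisym)
  interpret vector_space_pair qscale tscale by unfold_locales
  interpret Vector_Spaces.linear qscale tscale abs_tensor_algebra
    by (rule linear_abs_tensor_algebra)
  have "abs_tensor_algebra p \<in> tvec.span (range pure_tensor)" for p :: "('a \<Rightarrow>\<^sub>0 rat) list \<Rightarrow>\<^sub>0 rat"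
  proof -
    have "p \<in> qvec.span (range basis_vec)" by (simp add: span_basis_vec)
    then have "abs_tensor_algebra p \<in> abs_tensor_algebra ` qvec.span (range basis_vec)" by blast
    also have "\<dots> = tvec.span (range pure_tensor)"
      by (simp add: span_image[symmetric] image_image pure_tensor_def[abs_def])
    finally show ?thesis .
  qed
  then have "t \<in> tvec.span (range pure_tensor)" for t :: "'a tensor_algebra"
    by (induct t rule: tensor_algebra.abs_induct)
  moreover have "tvec.span (range pure_tensor) \<subseteq> tvec.span (range (basis_tensor :: 'a list \<Rightarrow> _))"
  proof (rule tvec.span_minimal)
    show "range pure_tensor \<subseteq> tvec.span (range (basis_tensor :: 'a list \<Rightarrow> _))"
    proof (rule image_subsetI)
      fix vs :: "('a \<Rightarrow>\<^sub>0 rat) list"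
      have "pure_tensor vs \<in> tvec.span (basis_tensor ` {w. length w = length vs})"
        using pure_tensor_in_span_basis_tensors[of "[]" UNIV vs] by (simp add: span_basis_vec)
      also have "\<dots> \<subseteq> tvec.span (range basis_tensor)"
        by (intro tvec.span_mono image_mono subset_UNIV)
      finally show "pure_tensor vs \<in> tvec.span (range basis_tensor)" .
    qed
  qed (rule tvec.subspace_span)
  ultimately show "UNIV \<subseteq> tvec.span (range (basis_tensor :: 'a list \<Rightarrow> _))" by blast
qed simp

lemma linear_eq_on_basis_tensors:
  assumes "Vector_Spaces.linear tscale s f" "Vector_Spaces.linear tscale s g"
    and "\<And>w. f (basis_tensor w) = g (basis_tensor w)"
  shows "f t = g t"
proof -
  interpret f: Vector_Spaces.linear tscale s f by fact
  interpret vector_space_pair tscale s by unfold_locales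
  have "t \<in> tvec.span (range basis_tensor)" by (simp add: span_basis_tensors)
  then show ?thesis by (rule linear_eq_on[OF assms(1,2)]) (use assms(3) in auto)
qed

text \<open>
  Sending a word to the corresponding tensor of basis vectors gives a left inverse, which is checked
  on the spanning set of such tensors.
\<close>

lemma inj_tensor_to_poly: "inj (tensor_to_poly :: 'a tensor_algebra \<Rightarrow> _)"
proof -
  define poly_to_tensor :: "('a list \<Rightarrow>\<^sub>0 rat) \<Rightarrow> 'a tensor_algebra"
    where "poly_to_tensor = linear_extension tscale basis_tensor"
  have "Vector_Spaces.linear tscale tscale (poly_to_tensor \<circ> tensor_to_poly)"
    unfolding poly_to_tensor_def
    by (rule Vector_Spaces.linear_compose[OF linear_tensor_to_poly
          linear_linear_extension[OF tvec.vector_space_axioms]])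
  then have "(poly_to_tensor \<circ> tensor_to_poly) t = id t" for t
    by (rule linear_eq_on_basis_tensors[OF _ tvec.linear_id])
      (simp add: poly_to_tensor_def tensor_to_poly_basis_tensor tvec.vector_space_axioms)
  then show ?thesis by (metis comp_apply id_apply injI)
qed

lemma tensor_to_poly_tensor_power:
  "tensor_to_poly ` tensor_power (qvec.span (basis_vec ` A)) d
    = {p. \<forall>w\<in>Poly_Mapping.keys p. length w = d \<and> set w \<subseteq> A}"
proof -
  interpret Vector_Spaces.linear tscale qscale tensor_to_poly by (rule linear_tensor_to_poly)
  show ?thesis
    unfolding tensor_power_eq_span_basis_tensors
    by (auto simp: span_image[symmetric] image_image tensor_to_poly_basis_tensor span_basis_vec)
qed

lemma tensor_to_poly_diagonal_act:
  "tensor_to_poly (diagonal_act \<sigma> t) = relabel (map \<sigma>) (tensor_to_poly t)"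
proof -
  have "(tensor_to_poly \<circ> diagonal_act \<sigma>) t = (relabel (map \<sigma>) \<circ> tensor_to_poly) t"
  proof (rule linear_eq_on_basis_tensors)
    show "Vector_Spaces.linear tscale qscale (tensor_to_poly \<circ> diagonal_act \<sigma>)"
      by (rule Vector_Spaces.linear_compose[OF linear_diagonal_act linear_tensor_to_poly])
    show "Vector_Spaces.linear tscale qscale (relabel (map \<sigma>) \<circ> tensor_to_poly)"
      by (rule Vector_Spaces.linear_compose[OF linear_tensor_to_poly linear_relabel])
    fix w :: "'a list"
    have "diagonal_act \<sigma> (basis_tensor w) = basis_tensor (map \<sigma> w)"
      by (simp add: diagonal_act_pure_tensor comp_def)
    then show "(tensor_to_poly \<circ> diagonal_act \<sigma>) (basis_tensor w)
        = (relabel (map \<sigma>) \<circ> tensor_to_poly) (basis_tensor w)"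
      by (simp add: tensor_to_poly_basis_tensor del: map_map)
  qed
  then show ?thesis by simp
qed

lemma tensor_to_poly_invariants:
  "tensor_to_poly ` sym_invariants n diagonal_act (tensor_power (perm_module n) d)
    = sym_invariants n nc_act (nc_homogeneous n d)"
proof -
  have image: "tensor_to_poly ` tensor_power (perm_module n) d = nc_homogeneous n d"
    unfolding perm_module_def nc_homogeneous_def by (rule tensor_to_poly_tensor_power)
  have "diagonal_act \<sigma> t = t \<longleftrightarrow> nc_act \<sigma> (tensor_to_poly t) = tensor_to_poly t" for \<sigma> t
    by (metis inj_tensor_to_poly injD nc_act_def tensor_to_poly_diagonal_act)
  then show ?thesis unfolding sym_invariants_def image[symmetric] by auto
qed

section \<open>Restricted growth words\<close>

text \<open>
  Intervals \<open>[1..<Suc n]\<close> serve as the sorted list of \<open>{1..n}\<close>; the two rules would rewrite them, and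
  the sets, into forms that no longer match.
\<close>

declare One_nat_def [simp del] upt_Suc [simp del]

text \<open>
  Like \<open>remdups\<close>, except that \<open>remdups\<close> keeps the last occurrence of each letter.
\<close>

primrec first_occurrences :: "'a list \<Rightarrow> 'a list"
  where
    "first_occurrences [] = []"
  | "first_occurrences (a # w) = a # removeAll a (first_occurrences w)"

lemma set_first_occurrences [simp]: "set (first_occurrences w) = set w"
  by (induction w) auto

lemma distinct_first_occurrences: "distinct (first_occurrences w)"
  by (induction w) (auto simp: distinct_removeAll)

lemma first_occurrences_map:
  assumes "inj f"
  shows "first_occurrences (map f w) = map f (first_occurrences w)"
  by (induction w) (auto simp: map_removeAll_inj[OF assms])

definition restricted_growth :: "nat list \<Rightarrow> bool"
  where "restricted_growth w \<longleftrightarrow> (\<exists>m. first_occurrences w = [1..<Suc m])"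

definition words :: "nat \<Rightarrow> nat \<Rightarrow> nat list set"
  where "words n d = {w. length w = d \<and> set w \<subseteq> {1..n}}"

lemma finite_words: "finite (words n d)"
  using finite_lists_length_eq[of "{1..n}" d] by (simp add: words_def conj_commute)

text \<open>
  The deck of cards \<open>1, \<dots>, n\<close> after moving the cards of \<open>w\<close> to the front, starting from the initial
  order; the head of \<open>w\<close> is the card moved last. It also completes the letters of \<open>w\<close>, in order of
  first appearance, to a permutation of \<open>{1..n}\<close>.
\<close>

definition deck :: "nat \<Rightarrow> nat list \<Rightarrow> nat list"
  where "deck n w = first_occurrences w @ filter (\<lambda>i. i \<notin> set w) [1..<Suc n]"

lemma deck_Cons: "deck n (a # w) = a # removeAll a (deck n w)"
  by (auto simp: deck_def removeAll_filter_not_eq intro!: filter_cong)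

lemma restricted_growth_iff_deck:
  assumes "set w \<subseteq> {1..n}"
  shows "restricted_growth w \<longleftrightarrow> deck n w = [1..<Suc n]"
proof
  assume "restricted_growth w"
  then obtain m where m: "first_occurrences w = [1..<Suc m]" by (auto simp: restricted_growth_def)
  then have set: "set w = {1..m}" by (metis atLeastLessThanSuc_atLeastAtMost set_first_occurrences set_upt)
  with assms have "m \<le> n" by (cases "m = 0") auto
  then have upt: "[1..<Suc n] = [1..<Suc m] @ [Suc m..<Suc n]"
    by (metis Suc_le_mono le_add1 plus_1_eq_Suc upt_add_eq_append le_add_diff_inverse)
  have "filter (\<lambda>i. i \<notin> set w) [1..<Suc n] = [Suc m..<Suc n]"
    unfolding upt filter_append by (auto simp: set filter_empty_conv filter_id_conv)
  then show "deck n w = [1..<Suc n]" by (simp only: deck_def m upt)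
next
  assume deck: "deck n w = [1..<Suc n]"
  define m where "m = length (first_occurrences w)"
  have "m \<le> n"
    using arg_cong[OF deck, of length] by (simp add: deck_def m_def)
  have "first_occurrences w = take m (deck n w)" by (simp add: deck_def m_def)
  also have "\<dots> = [1..<Suc m]" using \<open>m \<le> n\<close> by (simp add: deck plus_1_eq_Suc)
  finally show "restricted_growth w" by (auto simp: restricted_growth_def)
qed

text \<open>
  The deck lists \<open>{1..n}\<close> with the letters of \<open>w\<close> first, in order of appearance. The permutation
  sending each card to its position in the deck therefore renames the letters of \<open>w\<close> to
  \<open>1, \<dots>, m\<close> in the right order.
\<close>

lemma ex_restricted_growth_in_orbit:
  assumes "set w \<subseteq> {1..n}"
  obtains \<sigma> where "\<sigma> permutes {1..n}" "restricted_growth (map \<sigma> w)"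
proof -
  have set: "set (deck n w) = {1..n}" using assms by (auto simp: deck_def)
  have dist: "distinct (deck n w)"
    by (auto simp: deck_def distinct_first_occurrences)
  have len: "length (deck n w) = n" using distinct_card[OF dist] set by simp
  \<comment> \<open>\<open>\<rho>\<close> sends a position to the card there, so its inverse sends a card to its position.\<close>
  define \<rho> where "\<rho> i = (if i \<in> {1..n} then deck n w ! (i - 1) else i)" for i
  have map\<rho>: "map \<rho> [1..<Suc n] = deck n w"
    by (rule nth_equalityI) (auto simp: len \<rho>_def)
  have "\<rho> permutes {1..n}"
  proof (rule bij_imp_permutes)
    have "\<rho> ` {1..n} = {1..n}"
      by (metis map\<rho> set set_map set_upt atLeastLessThanSuc_atLeastAtMost)
    then show "bij_betw \<rho> {1..n} {1..n}"
      by (simp add: bij_betw_def eq_card_imp_inj_on)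
  qed (auto simp: \<rho>_def)
  then have perm: "inv' \<rho> permutes {1..n}" and inv: "inv' \<rho> \<circ> \<rho> = id"
    by (auto simp: permutes_inv permutes_inv_o)
  define m where "m = length (first_occurrences w)"
  have "m \<le> n" using len by (simp add: deck_def m_def)
  have "first_occurrences (map (inv' \<rho>) w) = map (inv' \<rho>) (take m (deck n w))"
    by (simp add: first_occurrences_map[OF permutes_inj[OF perm]] deck_def m_def)
  also have "\<dots> = take m [1..<Suc n]"
    by (simp only: map\<rho>[symmetric] take_map[symmetric] map_map inv) simp
  also have "\<dots> = [1..<Suc m]" using \<open>m \<le> n\<close> by (simp add: plus_1_eq_Suc)
  finally have "restricted_growth (map (inv' \<rho>) w)" by (auto simp: restricted_growth_def)
  with perm show thesis by (rule that)
qed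

text \<open>
  Renaming commutes with taking first occurrences, so \<open>\<sigma>\<close> must map the list \<open>1, \<dots>, m\<close> of the letters
  of \<open>w\<close> to a list \<open>1, \<dots>, m'\<close> of the same length, that is, fix every letter.
\<close>

lemma restricted_growth_unique_in_orbit:
  assumes "restricted_growth w" "restricted_growth (map \<sigma> w)" "inj \<sigma>"
  shows "map \<sigma> w = w"
proof -
  obtain m m' where m: "first_occurrences w = [1..<Suc m]"
    and m': "first_occurrences (map \<sigma> w) = [1..<Suc m']"
    using assms by (auto simp: restricted_growth_def)
  have eq: "map \<sigma> (first_occurrences w) = [1..<Suc m']"
    using m' by (simp add: first_occurrences_map[OF assms(3)])
  have "m = m'" using arg_cong[OF eq, of length] by (simp add: m)
  with eq m have "map \<sigma> (first_occurrences w) = map id (first_occurrences w)" by simp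
  then have "\<forall>x\<in>set (first_occurrences w). \<sigma> x = id x" by (simp only: map_eq_conv)
  then show ?thesis
    by (intro map_idI) simp
qed

section \<open>Orbit sums\<close>

definition word_orbit :: "nat \<Rightarrow> nat list \<Rightarrow> nat list set"
  where "word_orbit n w = (\<lambda>\<sigma>. map \<sigma> w) ` {\<sigma>. \<sigma> permutes {1..n}}"

definition orbit_sum :: "nat \<Rightarrow> nat list \<Rightarrow> nc_poly"
  where "orbit_sum n w = (\<Sum>u\<in>word_orbit n w. basis_vec u)"

lemma lookup_orbit_sum:
  "Poly_Mapping.lookup (orbit_sum n w) u = (if u \<in> word_orbit n w then 1 else 0)"
  unfolding orbit_sum_def
  by (rule lookup_sum_basis_vecs) (simp add: word_orbit_def finite_permutations)

lemma word_orbit_subset_words: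
  assumes "w \<in> words n d"
  shows "word_orbit n w \<subseteq> words n d"
proof (unfold word_orbit_def, rule image_subsetI)
  fix \<sigma> assume "\<sigma> \<in> {\<sigma>. \<sigma> permutes {1..n}}"
  then have "\<sigma> ` {1..n} = {1..n}" by (simp add: permutes_image)
  then show "map \<sigma> w \<in> words n d" using assms by (auto simp: words_def)
qed

lemma self_in_word_orbit: "w \<in> word_orbit n w"
  unfolding word_orbit_def by (rule image_eqI[of _ _ id]) (auto simp: permutes_id)

lemma map_permutes_mem_word_orbit_iff:
  assumes "\<sigma> permutes {1..n}"
  shows "map \<sigma> u \<in> word_orbit n w \<longleftrightarrow> u \<in> word_orbit n w"
proof
  assume "map \<sigma> u \<in> word_orbit n w"
  then obtain \<tau> where \<tau>: "\<tau> permutes {1..n}" "map \<sigma> u = map \<tau> w" by (auto simp: word_orbit_def)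
  have "u = map (inv' \<sigma>) (map \<sigma> u)" using permutes_inv_o(2)[OF assms] by simp
  also have "\<dots> = map (inv' \<sigma> \<circ> \<tau>) w" using \<tau> by simp
  finally show "u \<in> word_orbit n w"
    unfolding word_orbit_def using \<tau> assms by (blast intro: permutes_compose permutes_inv)
next
  assume "u \<in> word_orbit n w"
  then obtain \<tau> where \<tau>: "\<tau> permutes {1..n}" "u = map \<tau> w" by (auto simp: word_orbit_def)
  then have "map \<sigma> u = map (\<sigma> \<circ> \<tau>) w" by simp
  then show "map \<sigma> u \<in> word_orbit n w"
    unfolding word_orbit_def using \<tau> assms by (blast intro: permutes_compose)
qed

lemma invariants_iff:
  "p \<in> sym_invariants n nc_act (nc_homogeneous n d) \<longleftrightarrow>
    Poly_Mapping.keys p \<subseteq> words n d \<and>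
    (\<forall>\<sigma> w. \<sigma> permutes {1..n} \<longrightarrow> Poly_Mapping.lookup p (map \<sigma> w) = Poly_Mapping.lookup p w)"
proof -
  have "nc_act \<sigma> p = p \<longleftrightarrow> (\<forall>w. Poly_Mapping.lookup p (map \<sigma> w) = Poly_Mapping.lookup p w)"
    if \<sigma>: "\<sigma> permutes {1..n}" for \<sigma>
  proof -
    have inj: "inj (map \<sigma>)" using permutes_inj[OF \<sigma>] by simp
    have surj: "\<exists>u. w = map \<sigma> u" for w
      by (rule exI[of _ "map (inv' \<sigma>) w"]) (simp add: permutes_inv_o(1)[OF \<sigma>])
    have "nc_act \<sigma> p = p \<longleftrightarrow>
        (\<forall>w. Poly_Mapping.lookup (nc_act \<sigma> p) (map \<sigma> w) = Poly_Mapping.lookup p (map \<sigma> w))"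
      by (metis poly_mapping_eqI surj)
    then show ?thesis by (auto simp: nc_act_def lookup_relabel_inj[OF inj])
  qed
  then show ?thesis
    by (auto simp: sym_invariants_def nc_homogeneous_def words_def sym_group_carrier)
qed

text \<open>
  The orbit sums of the restricted growth words are a basis: the coefficient of a combination of them
  at a restricted growth word \<open>u\<close> is the scalar in front of the orbit sum of \<open>u\<close>, and an invariant
  polynomial is determined by its coefficients at restricted growth words.
\<close>

lemma dim_invariant_polys:
  "qvec.dim (sym_invariants n nc_act (nc_homogeneous n d))
    = card {w \<in> words n d. restricted_growth w}"
proof (rule qvec.dim_unique)
  let ?R = "{w \<in> words n d. restricted_growth w}"
  have finite: "finite ?R" using finite_words by simp
  have lookup: "Poly_Mapping.lookup (orbit_sum n w) u = (if u = w then 1 else 0)"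
    if "w \<in> ?R" "u \<in> ?R" for w u
    using that restricted_growth_unique_in_orbit self_in_word_orbit
    by (auto simp: lookup_orbit_sum word_orbit_def permutes_inj)
  have lookup_comb: "Poly_Mapping.lookup (\<Sum>w\<in>?R. qscale (c w) (orbit_sum n w)) u = c u"
    if "u \<in> ?R" for c u
  proof -
    have "Poly_Mapping.lookup (\<Sum>w\<in>?R. qscale (c w) (orbit_sum n w)) u
        = (\<Sum>w\<in>?R. c w * (if u = w then 1 else 0))"
      unfolding lookup_sum lookup_qscale using that by (intro sum.cong) (simp_all only: lookup)
    also have "\<dots> = c u"
      using that finite
      by (simp add: if_distrib[of "(*) _"] del: mem_Collect_eq cong: if_cong)
    finally show ?thesis .
  qed
  have inj: "inj_on (orbit_sum n) ?R"
  proof (rule inj_onI)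
    fix w u assume w: "w \<in> ?R" and u: "u \<in> ?R" and eq: "orbit_sum n w = orbit_sum n u"
    have "(if w = u then 1 else 0) = (1 :: rat)"
      using lookup[OF u w] lookup[OF w w] by (simp add: eq del: mem_Collect_eq)
    then show "w = u" by (simp split: if_splits)
  qed
  then show "card (orbit_sum n ` ?R) = card ?R" by (rule card_image)
  show "orbit_sum n ` ?R \<subseteq> sym_invariants n nc_act (nc_homogeneous n d)"
  proof (rule image_subsetI)
    fix w assume "w \<in> ?R"
    then have "word_orbit n w \<subseteq> words n d" by (intro word_orbit_subset_words) simp
    then show "orbit_sum n w \<in> sym_invariants n nc_act (nc_homogeneous n d)"
      by (auto simp: invariants_iff in_keys_iff lookup_orbit_sum map_permutes_mem_word_orbit_iff
          split: if_splits)
  qed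
  show "qvec.independent (orbit_sum n ` ?R)"
  proof (rule qvec.independent_if_scalars_zero)
    fix f x assume 0: "(\<Sum>x\<in>orbit_sum n ` ?R. qscale (f x) x) = 0" and "x \<in> orbit_sum n ` ?R"
    then obtain u where u: "u \<in> ?R" "x = orbit_sum n u" by blast
    have "(\<Sum>w\<in>?R. qscale (f (orbit_sum n w)) (orbit_sum n w)) = 0"
      using 0 by (simp add: sum.reindex[OF inj])
    then show "f x = 0" using lookup_comb[OF u(1), of "f \<circ> orbit_sum n"] u(2) by simp
  qed (use finite in simp)
  show "sym_invariants n nc_act (nc_homogeneous n d) \<subseteq> qvec.span (orbit_sum n ` ?R)"
  proof
    fix p assume "p \<in> sym_invariants n nc_act (nc_homogeneous n d)"
    then have keys: "Poly_Mapping.keys p \<subseteq> words n d"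
      and invariant: "\<And>\<sigma> w. \<sigma> permutes {1..n} \<Longrightarrow>
        Poly_Mapping.lookup p (map \<sigma> w) = Poly_Mapping.lookup p w"
      by (auto simp: invariants_iff)
    let ?q = "\<Sum>w\<in>?R. qscale (Poly_Mapping.lookup p w) (orbit_sum n w)"
    have "p = ?q"
    proof (rule poly_mapping_eqI)
      fix u
      show "Poly_Mapping.lookup p u = Poly_Mapping.lookup ?q u"
      proof (cases "u \<in> words n d")
        case True
        then obtain \<sigma> where \<sigma>: "\<sigma> permutes {1..n}" "restricted_growth (map \<sigma> u)"
          using ex_restricted_growth_in_orbit[of u n] by (auto simp: words_def)
        have "map \<sigma> u \<in> word_orbit n u" using \<sigma> by (auto simp: word_orbit_def)
        with True \<sigma> have R: "map \<sigma> u \<in> ?R" using word_orbit_subset_words by blast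
        have "Poly_Mapping.lookup p u = Poly_Mapping.lookup p (map \<sigma> u)" using invariant \<sigma>(1) by simp
        also have "\<dots> = Poly_Mapping.lookup ?q (map \<sigma> u)" by (rule lookup_comb[OF R, symmetric])
        also have "\<dots> = Poly_Mapping.lookup ?q u"
          by (simp add: lookup_sum lookup_orbit_sum map_permutes_mem_word_orbit_iff[OF \<sigma>(1)])
        finally show ?thesis .
      next
        case False
        then have "u \<notin> word_orbit n w" if "w \<in> ?R" for w
          using that word_orbit_subset_words by blast
        then have "Poly_Mapping.lookup ?q u = 0" by (simp add: lookup_sum lookup_orbit_sum)
        moreover have "Poly_Mapping.lookup p u = 0" using False keys by (auto simp: in_keys_iff)
        ultimately show ?thesis by simp
      qed
    qed
    also have "?q \<in> qvec.span (orbit_sum n ` ?R)"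
      by (intro qvec.span_sum qvec.span_scale qvec.span_base) blast
    finally show "p \<in> qvec.span (orbit_sum n ` ?R)" .
  qed
qed

section \<open>Moving cards to the front\<close>

text \<open>The letter \<open>e\<close> fits the general pattern as the trivial cycle \<open>(1)\<close>.\<close>

lemma cayley_gens_eq:
  assumes "n \<ge> 1"
  shows "cayley_gens n = gen_cycle ` {1..n}"
proof -
  have "gen_cycle 1 = id" by (simp add: gen_cycle_def)
  moreover have "{1..n} = insert 1 {2..n}" using assms by auto
  ultimately show ?thesis by (simp add: cayley_gens_def sym_group_one)
qed

lemma gen_cycle_permutes:
  assumes "k \<in> {1..n}"
  shows "gen_cycle k permutes {1..n}"
  unfolding gen_cycle_def
  by (rule permutes_subset[OF cycle_permutes]) (use assms in auto)

text \<open>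
  A cycle rotates the list that defines it. The list \<open>1, k, \<dots>, 2\<close> has a descending tail, so the
  rotation is read off after reversing.
\<close>

lemma gen_cycle_values:
  assumes "k \<ge> 1"
  shows "gen_cycle k 1 = k" "map (gen_cycle k) [2..<Suc k] = [1..<k]"
proof -
  let ?cs = "1 # rev [2..<Suc k]"
  have "map (gen_cycle k) ?cs = rotate1 ?cs"
    unfolding gen_cycle_def using cyclic_rotation[of ?cs 1] by (simp add: One_nat_def)
  then have "rev (map (gen_cycle k) ?cs) = rev (rotate1 ?cs)" by (rule arg_cong)
  then have "map (gen_cycle k) [2..<Suc k] @ [gen_cycle k 1] = 1 # [2..<Suc k]"
    by (simp add: rev_map)
  also have "\<dots> = [1..<Suc k]" using assms by (simp add: upt_conv_Cons numeral_2_eq_2)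
  also have "\<dots> = [1..<k] @ [k]" using assms by (simp add: upt_Suc)
  finally show "gen_cycle k 1 = k" "map (gen_cycle k) [2..<Suc k] = [1..<k]" by simp_all
qed

text \<open>
  In terms of decks: the cycle moves the card at position \<open>k\<close> to the front and keeps the others in
  order.
\<close>

lemma map_gen_cycle:
  assumes "k \<in> {1..n}"
  shows "map (gen_cycle k) [1..<Suc n] = k # removeAll k [1..<Suc n]"
proof -
  have split: "[1..<Suc n] = [1] @ [2..<Suc k] @ [Suc k..<Suc n]"
    "[1..<Suc n] = [1..<k] @ [k] @ [Suc k..<Suc n]"
    using assms upt_add_eq_append[of 2 "Suc k" "n - k"] upt_add_eq_append[of 1 k "Suc n - k"]
      upt_conv_Cons[of 1 "Suc n"] upt_conv_Cons[of k "Suc n"]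
    by (auto simp: numeral_2_eq_2 One_nat_def)
  have "gen_cycle k i = i" if "i \<in> {Suc k..<Suc n}" for i
    unfolding gen_cycle_def by (rule id_outside_supp) (use that assms in auto)
  then have "map (gen_cycle k) [Suc k..<Suc n] = [Suc k..<Suc n]"
    by (intro map_idI) simp
  moreover have "removeAll k [1..<Suc n] = [1..<k] @ [Suc k..<Suc n]"
    unfolding split(2) by simp
  ultimately show ?thesis
    using gen_cycle_values[of k] assms unfolding split(1) by simp
qed

text \<open>
  Lists of positions are read from the right, so that the head is the last move. A move acts on
  positions and is therefore composed on the right.
\<close>

primrec shuffle :: "nat list \<Rightarrow> nat \<Rightarrow> nat"
  where
    "shuffle [] = id"
  | "shuffle (k # ks) = shuffle ks \<circ> gen_cycle k"

primrec moved_cards :: "nat list \<Rightarrow> nat list"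
  where
    "moved_cards [] = []"
  | "moved_cards (k # ks) = shuffle ks k # moved_cards ks"

lemma shuffle_permutes: "set ks \<subseteq> {1..n} \<Longrightarrow> shuffle ks permutes {1..n}"
  by (induction ks) (auto simp: permutes_id intro!: permutes_compose gen_cycle_permutes)

text \<open>
  A word in the Cayley graph lists its first letter first, hence the reversal.
\<close>

lemma foldr_comp_gen_cycle: "foldr (\<circ>) (map gen_cycle (rev ks)) id = shuffle ks"
proof -
  have "foldr (\<circ>) (map gen_cycle (rev ks)) f = shuffle ks \<circ> f" for f
    by (induction ks arbitrary: f) (auto simp: comp_assoc)
  from this[of id] show ?thesis by simp
qed

text \<open>
  Each move takes one card out of the deck and puts it on top, which is also how \<open>deck\<close> grows when a
  letter is added in front (\<open>deck_Cons\<close>).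
\<close>

lemma map_shuffle_eq_deck:
  "set ks \<subseteq> {1..n} \<Longrightarrow> map (shuffle ks) [1..<Suc n] = deck n (moved_cards ks)"
proof (induction ks)
  case Nil
  show ?case by (simp add: deck_def)
next
  case (Cons k ks)
  have "inj (shuffle ks)" using Cons.prems shuffle_permutes[of ks n] by (simp add: permutes_inj)
  have "map (shuffle (k # ks)) [1..<Suc n] = map (shuffle ks) (map (gen_cycle k) [1..<Suc n])"
    by simp
  also have "\<dots> = shuffle ks k # removeAll (shuffle ks k) (map (shuffle ks) [1..<Suc n])"
    using Cons.prems
    by (simp add: map_gen_cycle map_removeAll_inj[OF \<open>inj (shuffle ks)\<close>])
  also have "\<dots> = deck n (moved_cards (k # ks))"
    using Cons by (simp add: deck_Cons)
  finally show ?case .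
qed

lemma shuffle_eq_id_iff:
  assumes "set ks \<subseteq> {1..n}"
  shows "shuffle ks = id \<longleftrightarrow> deck n (moved_cards ks) = [1..<Suc n]"
proof -
  have "shuffle ks = id \<longleftrightarrow> (\<forall>i\<in>{1..n}. shuffle ks i = i)"
    using shuffle_permutes[OF assms] by (auto simp: permutes_def fun_eq_iff)
  also have "\<dots> \<longleftrightarrow> map (shuffle ks) [1..<Suc n] = map id [1..<Suc n]"
    unfolding map_eq_conv by (auto)
  finally show ?thesis by (simp add: map_shuffle_eq_deck[OF assms])
qed

text \<open>
  The positions can be recovered from the cards: once the earlier moves are known, so is the current
  deck, and a card determines its position. Surjectivity follows by finiteness.
\<close>

lemma bij_betw_moved_cards: "bij_betw moved_cards (words n d) (words n d)"
proof -
  have len: "length (moved_cards ks) = length ks" for ks by (induction ks) auto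
  have "set ks \<subseteq> {1..n} \<Longrightarrow> set (moved_cards ks) \<subseteq> {1..n}" for ks
    by (induction ks) (use permutes_in_image[OF shuffle_permutes] in auto)
  then have into: "moved_cards ` words n d \<subseteq> words n d" by (auto simp: words_def len)
  have "ks = ls" if "moved_cards ks = moved_cards ls" "set ks \<subseteq> {1..n}" for ks ls
    using that
  proof (induction ks arbitrary: ls)
    case Nil
    then show ?case by (cases ls) auto
  next
    case (Cons k ks)
    then obtain l ls' where ls: "ls = l # ls'" by (cases ls) auto
    with Cons have "ks = ls'" by simp
    moreover have "inj (shuffle ks)"
      using Cons.prems shuffle_permutes[of ks n] by (simp add: permutes_inj)
    ultimately show ?case using Cons.prems ls by (simp add: inj_eq)
  qed
  then have "inj_on moved_cards (words n d)" by (auto simp: inj_on_def words_def)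
  then show ?thesis
    using endo_inj_surj[OF finite_words into] by (simp add: bij_betw_def)
qed

lemma card_cayley_words:
  assumes "n \<ge> 1"
  shows "card (cayley_words (sym_group n) (cayley_gens n) d \<one>\<^bsub>sym_group n\<^esub>)
    = card {w \<in> words n d. restricted_growth w}"
proof -
  let ?K = "{ks \<in> words n d. shuffle ks = id}"
  let ?word = "\<lambda>ks. map gen_cycle (rev ks)"
  have inj: "inj_on gen_cycle {1..n}"
    by (rule inj_onI) (metis atLeastAtMost_iff gen_cycle_values(1))
  have "inj_on ?word ?K"
  proof (rule inj_onI)
    fix ks ls assume "ks \<in> ?K" "ls \<in> ?K" and eq: "?word ks = ?word ls"
    then have "inj_on gen_cycle (set (rev ks) \<union> set (rev ls))"
      by (intro inj_on_subset[OF inj]) (simp add: words_def)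
    with eq have "rev ks = rev ls" by (rule map_inj_on)
    then show "ks = ls" by simp
  qed
  moreover have "cayley_words (sym_group n) (cayley_gens n) d \<one>\<^bsub>sym_group n\<^esub> = ?word ` ?K"
  proof (intro subset_antisym subsetI)
    fix ss assume "ss \<in> cayley_words (sym_group n) (cayley_gens n) d \<one>\<^bsub>sym_group n\<^esub>"
    then have len: "length ss = d" and set: "set ss \<subseteq> gen_cycle ` {1..n}"
      and prod: "foldr (\<circ>) ss id = id"
      using assms by (auto simp: cayley_words_def cayley_gens_eq sym_group_mult sym_group_one)
    have "ss \<in> map gen_cycle ` lists {1..n}"
      using set by (simp add: lists_image[symmetric] in_lists_conv_set subset_iff)
    then obtain ks where ks: "ss = map gen_cycle ks" "set ks \<subseteq> {1..n}"
      by (auto simp: in_lists_conv_set)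
    then have "rev ks \<in> ?K" "ss = ?word (rev ks)"
      using len prod foldr_comp_gen_cycle[of "rev ks"] by (auto simp: words_def)
    then show "ss \<in> ?word ` ?K" by blast
  next
    fix ss assume "ss \<in> ?word ` ?K"
    then obtain ks where "ks \<in> ?K" "ss = ?word ks" by blast
    moreover from this have "set ss \<subseteq> gen_cycle ` {1..n}" by (auto simp: words_def)
    ultimately show "ss \<in> cayley_words (sym_group n) (cayley_gens n) d \<one>\<^bsub>sym_group n\<^esub>"
      using assms foldr_comp_gen_cycle[of ks]
      by (simp add: cayley_words_def cayley_gens_eq sym_group_mult sym_group_one words_def)
  qed
  ultimately have "card (cayley_words (sym_group n) (cayley_gens n) d \<one>\<^bsub>sym_group n\<^esub>) = card ?K"
    by (simp add: card_image)
  also have "\<dots> = card {w \<in> words n d. restricted_growth w}"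
  proof (rule bij_betw_same_card)
    have iff: "shuffle ks = id \<longleftrightarrow> restricted_growth (moved_cards ks)" if "ks \<in> words n d" for ks
    proof -
      have "moved_cards ks \<in> words n d" using bij_betw_moved_cards that by (rule bij_betwE[rule_format])
      then show ?thesis

        using that shuffle_eq_id_iff[of ks n] restricted_growth_iff_deck[of "moved_cards ks" n]
        by (simp add: words_def)
    qed
    then show "bij_betw moved_cards ?K {w \<in> words n d. restricted_growth w}"
      by (intro bij_betw_Collect[OF bij_betw_moved_cards]) simp
  qed
  finally show ?thesis .
qed

section \<open>The dimension formula\<close>

theorem corollary4p18:
  fixes n d :: nat
  assumes "n \<ge> 2"
  shows "(tvec.dim (sym_invariants n diagonal_act
            (tensor_power (internal_sum (trivial_module n) (geometric_module n)) d))
          = card (cayley_words (sym_group n) (cayley_gens n) d \<one>\<^bsub>sym_group n\<^esub>))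
    \<and> (qvec.dim (sym_invariants n nc_act (nc_homogeneous n d))
          = card (cayley_words (sym_group n) (cayley_gens n) d \<one>\<^bsub>sym_group n\<^esub>))
    \<and> (\<exists>f. Vector_Spaces.linear tscale qscale f \<and>
           bij_betw f
             (sym_invariants n diagonal_act
               (tensor_power (internal_sum (trivial_module n) (geometric_module n)) d))
             (sym_invariants n nc_act (nc_homogeneous n d)))"
proof -
  let ?T = "sym_invariants n diagonal_act
    (tensor_power (internal_sum (trivial_module n) (geometric_module n)) d)"
  let ?P = "sym_invariants n nc_act (nc_homogeneous n d)"
  have n: "n \<ge> 1" using assms by simp
  have image: "tensor_to_poly ` ?T = ?P"
    using tensor_to_poly_invariants by (simp add: perm_module_eq_sum[OF n])
  have P: "qvec.dim ?P = card (cayley_words (sym_group n) (cayley_gens n) d \<one>\<^bsub>sym_group n\<^esub>)"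
    by (simp add: dim_invariant_polys card_cayley_words[OF n])
  have "tvec.dim ?T = qvec.dim ?P"
    using dim_linear_image[OF linear_tensor_to_poly inj_tensor_to_poly, of ?T] image by simp
  moreover have "bij_betw tensor_to_poly ?T ?P"
    using image inj_on_subset[OF inj_tensor_to_poly subset_UNIV] by (simp add: bij_betw_def)
  ultimately show ?thesis using P linear_tensor_to_poly by auto
qed

end
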